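(* Let $n\in\mathbb{N}$ with $n\ge 2$, and let $x_0\in\mathbb{R}^n$. Let $\mathcal{DSC}(\mathbb{R}^n,x_0)$ be the set of all separately continuous functions $f:\mathbb{R}^n\to\mathbb{R}$ that are continuous at every point of $\mathbb{R}^n\setminus\{x_0\}$ and discontinuous at $x_0$. Then $\mathcal{DSC}(\mathbb{R}^n,x_0)$ is strongly $\mathfrak{c}$-algebrable.
   Context: $\mathfrak{c}$ denotes the cardinality of the continuum. A function $f:\mathbb{R}^n\to\mathbb{R}$ is separately continuous if for each $i\in\{1,\dots,n\}$ and each fixed choice of the other coordinates $(x_1,\dots,x_{i-1},x_{i+1},\dots,x_n)\in\mathbb{R}^{n-1}$, the map $x_i\mapsto f(x_1,\dots,x_n)$ is continuous on $\mathbb{R}$. A set $A$ of real-valued functions on $\mathbb{R}^n$ is strongly $\mathfrak{c}$-algebrable if there is a free algebra $M$ of functions (pointwise operations), freely generated by a set of $\mathfrak{c}$ generators, with $M\setminus\{0\}\subset A$. Equivalently, there is a set $B$ of functions $\mathbb{R}^n\to\mathbb{R}$ of cardinality $\mathfrak{c}$ such that for every $N\in\mathbb{N}$, every nonzero real polynomial $P$ in $N$ variables without constant term, and all distinct $f_1,\dots,f_N\in B$, one has $P(f_1,\dots,f_N)\neq 0$ and $P(f_1,\dots,f_N)\in A$. *)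

theory Defs
  imports "HOL-Analysis.Analysis" "HOL-Library.Poly_Mapping" "HOL-Library.Equipollence"
begin

section \<open>Separate continuity\<close>

definition separately_continuous :: "(real ^ 'n \<Rightarrow> real) \<Rightarrow> bool" where
  "separately_continuous f \<longleftrightarrow>
     (\<forall>i x. continuous_on UNIV (\<lambda>t. f (\<chi> j. if j = i then t else x $ j)))"

definition DSC :: "real ^ 'n \<Rightarrow> (real ^ 'n \<Rightarrow> real) set" where
  "DSC x0 = {f. separately_continuous f \<and> (\<forall>x. x \<noteq> x0 \<longrightarrow> isCont f x) \<and> \<not> isCont f x0}"


section \<open>Polynomials\<close>

text \<open>
  A real polynomial with variables indexed by \<open>'v\<close> is a finitely supported map from monomials
  to coefficients, a monomial being a finitely supported map from variables to exponents.
\<close>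

type_synonym 'v rpoly = "('v \<Rightarrow>\<^sub>0 nat) \<Rightarrow>\<^sub>0 real"

definition eval_monom :: "('v \<Rightarrow>\<^sub>0 nat) \<Rightarrow> ('v \<Rightarrow> real) \<Rightarrow> real" where
  "eval_monom m v = (\<Prod>i\<in>Poly_Mapping.keys m. v i ^ Poly_Mapping.lookup m i)"

definition eval_poly :: "'v rpoly \<Rightarrow> ('v \<Rightarrow> real) \<Rightarrow> real" where
  "eval_poly P v = (\<Sum>m\<in>Poly_Mapping.keys P. Poly_Mapping.lookup P m * eval_monom m v)"

definition poly_vars :: "'v rpoly \<Rightarrow> 'v set" where
  "poly_vars P = (\<Union>m\<in>Poly_Mapping.keys P. Poly_Mapping.keys m)"

text \<open>The coefficient of the monomial \<open>0\<close> (all exponents zero) is the constant term.\<close>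

definition no_const_term :: "'v rpoly \<Rightarrow> bool" where
  "no_const_term P \<longleftrightarrow> Poly_Mapping.lookup P 0 = 0"


section \<open>Strong algebrability\<close>

text \<open>Algebras of functions need not contain the constant functions.\<close>

definition function_algebra :: "('x \<Rightarrow> real) set \<Rightarrow> bool" where
  "function_algebra M \<longleftrightarrow>
     (\<lambda>x. 0) \<in> M \<and>
     (\<forall>f\<in>M. \<forall>g\<in>M. (\<lambda>x. f x + g x) \<in> M) \<and>
     (\<forall>f\<in>M. \<forall>g\<in>M. (\<lambda>x. f x * g x) \<in> M) \<and>
     (\<forall>c. \<forall>f\<in>M. (\<lambda>x. c * f x) \<in> M)"

text \<open>
  The polynomial \<open>P\<close> in the variables \<open>0, \<dots>, N - 1\<close> is evaluated at the functions
  \<open>f 0, \<dots>, f (N - 1)\<close>, which are required to be distinct elements of \<open>B\<close>.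
\<close>

definition algebraically_independent :: "('x \<Rightarrow> real) set \<Rightarrow> bool" where
  "algebraically_independent B \<longleftrightarrow>
     (\<forall>(N::nat) P f. poly_vars P \<subseteq> {..<N} \<longrightarrow> P \<noteq> 0 \<longrightarrow> no_const_term P \<longrightarrow>
        inj_on f {..<N} \<longrightarrow> f ` {..<N} \<subseteq> B \<longrightarrow>
        (\<lambda>x. eval_poly P (\<lambda>i. f i x)) \<noteq> (\<lambda>x. 0))"

definition freely_generates :: "('x \<Rightarrow> real) set \<Rightarrow> ('x \<Rightarrow> real) set \<Rightarrow> bool" where
  "freely_generates B M \<longleftrightarrow> M = function_algebra hull B \<and> algebraically_independent B"

definition strongly_c_algebrable :: "('x \<Rightarrow> real) set \<Rightarrow> bool" where
  "strongly_c_algebrable A \<longleftrightarrow>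
     (\<exists>M B. B \<approx> (UNIV :: real set) \<and> freely_generates B M \<and> M - {\<lambda>x. 0} \<subseteq> A)"


section \<open>The description of strong algebrability by polynomials\<close>

lemma function_algebra_hull: "function_algebra (function_algebra hull B)"
  by (rule hull_in) (auto simp: function_algebra_def)

lemma eval_monom_superset:
  assumes "finite S" "Poly_Mapping.keys m \<subseteq> S"
  shows "eval_monom m v = (\<Prod>i\<in>S. v i ^ Poly_Mapping.lookup m i)"
  unfolding eval_monom_def using assms
  by (intro prod.mono_neutral_left) (auto simp: in_keys_iff)

lemma eval_monom_0 [simp]: "eval_monom 0 v = 1"
  by (simp add: eval_monom_def)

lemma eval_monom_single [simp]: "eval_monom (Poly_Mapping.single i k) v = v i ^ k"
  by (simp add: eval_monom_def)

lemma eval_monom_add: "eval_monom (m + l) v = eval_monom m v * eval_monom l v"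
proof -
  let ?S = "Poly_Mapping.keys m \<union> Poly_Mapping.keys l"
  have "Poly_Mapping.keys (m + l) \<subseteq> ?S" by (rule Poly_Mapping.keys_add)
  then show ?thesis
    by (simp add: eval_monom_superset[of ?S] lookup_add power_add prod.distrib)
qed

lemma eval_monom_sum:
  "finite I \<Longrightarrow> eval_monom (\<Sum>i\<in>I. m i) v = (\<Prod>i\<in>I. eval_monom (m i) v)"
  by (induction I rule: finite_induct) (simp_all add: eval_monom_add)

lemma eval_poly_0 [simp]: "eval_poly 0 v = 0"
  by (simp add: eval_poly_def)

lemma eval_poly_single [simp]: "eval_poly (Poly_Mapping.single m c) v = c * eval_monom m v"
  by (simp add: eval_poly_def)

lemma eval_poly_superset:
  assumes "finite S" "Poly_Mapping.keys P \<subseteq> S"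
  shows "eval_poly P v = (\<Sum>m\<in>S. Poly_Mapping.lookup P m * eval_monom m v)"
  unfolding eval_poly_def using assms
  by (intro sum.mono_neutral_left) (auto simp: in_keys_iff)

lemma eval_poly_add: "eval_poly (P + Q) v = eval_poly P v + eval_poly Q v"
proof -
  let ?S = "Poly_Mapping.keys P \<union> Poly_Mapping.keys Q"
  have "Poly_Mapping.keys (P + Q) \<subseteq> ?S" by (rule Poly_Mapping.keys_add)
  then show ?thesis
    by (simp add: eval_poly_superset[of ?S] lookup_add distrib_right sum.distrib)
qed

lemma eval_poly_sum:
  "finite I \<Longrightarrow> eval_poly (\<Sum>i\<in>I. P i) v = (\<Sum>i\<in>I. eval_poly (P i) v)"
  by (induction I rule: finite_induct) (simp_all add: eval_poly_add)

lemma rpoly_sum_monoms: "P = (\<Sum>m\<in>Poly_Mapping.keys P. Poly_Mapping.single m (Poly_Mapping.lookup P m))"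
proof (rule poly_mapping_eqI)
  fix k
  have "Poly_Mapping.lookup (\<Sum>m\<in>Poly_Mapping.keys P. Poly_Mapping.single m (Poly_Mapping.lookup P m)) k
      = (\<Sum>m\<in>Poly_Mapping.keys P. if m = k then Poly_Mapping.lookup P m else 0)"
    unfolding lookup_sum by (intro sum.cong) (auto simp: lookup_single when_def)
  then show "Poly_Mapping.lookup P k = Poly_Mapping.lookup (\<Sum>m\<in>Poly_Mapping.keys P. Poly_Mapping.single m (Poly_Mapping.lookup P m)) k"
    by (simp add: in_keys_iff)
qed

lemma eval_poly_mult: "eval_poly (P * Q) v = eval_poly P v * eval_poly Q v"
proof -
  have "P * Q = (\<Sum>m\<in>Poly_Mapping.keys P. \<Sum>l\<in>Poly_Mapping.keys Q.
      Poly_Mapping.single (m + l) (Poly_Mapping.lookup P m * Poly_Mapping.lookup Q l))"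
    by (subst rpoly_sum_monoms[of P], subst rpoly_sum_monoms[of Q])
       (simp add: sum_product mult_single)
  then have "eval_poly (P * Q) v = (\<Sum>m\<in>Poly_Mapping.keys P. \<Sum>l\<in>Poly_Mapping.keys Q.
      (Poly_Mapping.lookup P m * Poly_Mapping.lookup Q l) * (eval_monom m v * eval_monom l v))"
    by (simp add: eval_poly_sum eval_monom_add)
  also have "\<dots> = eval_poly P v * eval_poly Q v"
    unfolding eval_poly_def sum_product by (simp add: mult_ac)
  finally show ?thesis .
qed

lemma no_const_term_add: "no_const_term P \<Longrightarrow> no_const_term Q \<Longrightarrow> no_const_term (P + Q)"
  by (simp add: no_const_term_def lookup_add)

lemma rpoly_monom_add_eq_0: "m + l = 0 \<Longrightarrow> m = (0 :: 'v \<Rightarrow>\<^sub>0 nat)"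
  by (metis add_is_0 lookup_add lookup_zero poly_mapping_eqI)

lemma no_const_term_mult:
  assumes "no_const_term P"
  shows "no_const_term (P * Q)"
proof -
  have "0 \<notin> Poly_Mapping.keys (P * Q)"
  proof
    assume "0 \<in> Poly_Mapping.keys (P * Q)"
    then obtain m l where "m \<in> Poly_Mapping.keys P" "0 = m + l"
      using keys_mult[of P Q] by blast
    then have "m \<in> Poly_Mapping.keys P" "m = 0"
      using rpoly_monom_add_eq_0[of m l] by auto
    with assms show False by (simp add: no_const_term_def in_keys_iff)
  qed
  then show ?thesis by (simp add: no_const_term_def in_keys_iff)
qed

lemma poly_vars_add: "poly_vars (P + Q) \<subseteq> poly_vars P \<union> poly_vars Q"
  using Poly_Mapping.keys_add[of P Q] by (force simp: poly_vars_def)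

lemma poly_vars_mult: "poly_vars (P * Q) \<subseteq> poly_vars P \<union> poly_vars Q"
proof
  fix i assume "i \<in> poly_vars (P * Q)"
  then obtain k where "k \<in> Poly_Mapping.keys (P * Q)" "i \<in> Poly_Mapping.keys k" by (auto simp: poly_vars_def)
  then obtain m l where "m \<in> Poly_Mapping.keys P" "l \<in> Poly_Mapping.keys Q" "i \<in> Poly_Mapping.keys (m + l)"
    using keys_mult[of P Q] by blast
  then show "i \<in> poly_vars P \<union> poly_vars Q"
    using Poly_Mapping.keys_add[of m l] by (fastforce simp: poly_vars_def)
qed

lemma function_algebra_sum:
  assumes "function_algebra M" "finite I" "\<And>i. i \<in> I \<Longrightarrow> g i \<in> M"
  shows "(\<lambda>x. \<Sum>i\<in>I. g i x) \<in> M"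
  using assms(2,3)
proof (induction I rule: finite_induct)
  case empty
  then show ?case using assms(1) by (simp add: function_algebra_def)
next
  case (insert j I)
  then show ?case using assms(1) by (simp add: function_algebra_def)
qed

lemma function_algebra_power:
  assumes "function_algebra M" "f \<in> M" "k > 0"
  shows "(\<lambda>x. f x ^ k) \<in> M"
  using assms(3)
proof (induction k rule: nat_induct_non_zero)
  case 1
  then show ?case using assms by simp
next
  case (Suc n)
  then show ?case using assms by (simp add: function_algebra_def)
qed

lemma function_algebra_prod:
  assumes "function_algebra M" "finite I" "I \<noteq> {}" "\<And>i. i \<in> I \<Longrightarrow> g i \<in> M"
  shows "(\<lambda>x. \<Prod>i\<in>I. g i x) \<in> M"
  using assms(2,3,4)
proof (induction I rule: finite_ne_induct)
  case (singleton j)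
  then show ?case by simp
next
  case (insert j I)
  then show ?case using assms(1) by (simp add: function_algebra_def)
qed

lemma eval_poly_in_function_algebra:
  assumes M: "function_algebra M" and P: "no_const_term P"
    and f: "\<And>i. i \<in> poly_vars P \<Longrightarrow> f i \<in> M"
  shows "(\<lambda>x. eval_poly P (\<lambda>i. f i x)) \<in> M"
  unfolding eval_poly_def
proof (rule function_algebra_sum[OF M])
  fix m assume m: "m \<in> Poly_Mapping.keys P"
  then have "m \<noteq> 0" using P by (auto simp: no_const_term_def in_keys_iff)
  then have "Poly_Mapping.keys m \<noteq> {}" by simp
  moreover have "(\<lambda>x. f i x ^ Poly_Mapping.lookup m i) \<in> M" if "i \<in> Poly_Mapping.keys m" for i
    using that m by (intro function_algebra_power M f) (auto simp: poly_vars_def in_keys_iff)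
  ultimately have "(\<lambda>x. eval_monom m (\<lambda>i. f i x)) \<in> M"
    unfolding eval_monom_def by (intro function_algebra_prod M) auto
  then show "(\<lambda>x. Poly_Mapping.lookup P m * eval_monom m (\<lambda>i. f i x)) \<in> M"
    using M by (simp add: function_algebra_def)
qed simp

text \<open>Here the elements of \<open>B\<close> themselves serve as the variables.\<close>

lemma function_algebra_hull_subset:
  "function_algebra hull B \<subseteq>
     {\<lambda>x. eval_poly P (\<lambda>g. g x) |P. poly_vars P \<subseteq> B \<and> no_const_term P}"
  (is "_ \<subseteq> ?S")
proof (rule hull_minimal)
  show "B \<subseteq> ?S"
  proof
    fix g assume g: "g \<in> B"
    let ?P = "Poly_Mapping.single (Poly_Mapping.single g 1) 1 :: ('a \<Rightarrow> real) rpoly"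
    have "g = (\<lambda>x. eval_poly ?P (\<lambda>g. g x))" by simp
    moreover have "poly_vars ?P \<subseteq> B" using g by (simp add: poly_vars_def)
    moreover have "no_const_term ?P"
      by (simp add: no_const_term_def lookup_single when_def flip: keys_eq_empty)
    ultimately show "g \<in> ?S" by blast
  qed
  show "function_algebra ?S"
    unfolding function_algebra_def
  proof (intro conjI ballI allI)
    show "(\<lambda>x. 0) \<in> ?S"
      by (intro CollectI exI[of _ 0]) (simp add: poly_vars_def no_const_term_def)
  next
    fix f g assume "f \<in> ?S" "g \<in> ?S"
    then obtain P Q where
      PQ: "f = (\<lambda>x. eval_poly P (\<lambda>g. g x))" "poly_vars P \<subseteq> B" "no_const_term P"
      "g = (\<lambda>x. eval_poly Q (\<lambda>g. g x))" "poly_vars Q \<subseteq> B" "no_const_term Q" by blast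
    show "(\<lambda>x. f x + g x) \<in> ?S"
      using PQ poly_vars_add[of P Q]
      by (intro CollectI exI[of _ "P + Q"]) (auto simp: eval_poly_add no_const_term_add)
    show "(\<lambda>x. f x * g x) \<in> ?S"
      using PQ poly_vars_mult[of P Q]
      by (intro CollectI exI[of _ "P * Q"]) (auto simp: eval_poly_mult no_const_term_mult)
  next
    fix c f assume "f \<in> ?S"
    then obtain P where
      P: "f = (\<lambda>x. eval_poly P (\<lambda>g. g x))" "poly_vars P \<subseteq> B" "no_const_term P" by blast
    let ?Q = "P * Poly_Mapping.single 0 c"
    have "poly_vars ?Q \<subseteq> B"
      using P poly_vars_mult[of P "Poly_Mapping.single 0 c"]
      by (auto simp: poly_vars_def split: if_splits)
    then show "(\<lambda>x. c * f x) \<in> ?S"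
      using P
      by (intro CollectI exI[of _ ?Q]) (auto simp: eval_poly_mult no_const_term_mult)
  qed
qed

lemma function_algebra_hull_eq_poly:
  assumes "g \<in> function_algebra hull B"
  obtains N :: nat and P f where "poly_vars P \<subseteq> {..<N}" "no_const_term P"
    "inj_on f {..<N}" "f ` {..<N} \<subseteq> B" "g = (\<lambda>x. eval_poly P (\<lambda>i. f i x))"
proof -
  from assms function_algebra_hull_subset obtain Q where
    Q: "g = (\<lambda>x. eval_poly Q (\<lambda>g. g x))" "poly_vars Q \<subseteq> B" "no_const_term Q" by blast
  have "finite (poly_vars Q)" by (simp add: poly_vars_def)
  then obtain f and N :: nat where "bij_betw f {..<N} (poly_vars Q)"
    using ex_bij_betw_nat_finite[of "poly_vars Q"] by (metis atLeast0LessThan)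
  then have inj: "inj_on f {..<N}" and im: "f ` {..<N} = poly_vars Q"
    by (auto simp: bij_betw_def)
  define h where "h = inv_into {..<N} f"
  have h: "h k < N" "f (h k) = k" if "k \<in> poly_vars Q" for k
    using that im inv_into_into[of k f "{..<N}"] f_inv_into_f[of k f "{..<N}"]
    by (auto simp: h_def)
  define r where "r m = (\<Sum>k\<in>Poly_Mapping.keys m. Poly_Mapping.single (h k) (Poly_Mapping.lookup m k))"
    for m :: "('a \<Rightarrow> real) \<Rightarrow>\<^sub>0 nat"
  have r_eval: "eval_monom (r m) (\<lambda>i. f i x) = eval_monom m (\<lambda>k. k x)" if "m \<in> Poly_Mapping.keys Q" for m x
  proof -
    have "eval_monom (r m) (\<lambda>i. f i x) = (\<Prod>k\<in>Poly_Mapping.keys m. f (h k) x ^ Poly_Mapping.lookup m k)"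
      unfolding r_def by (subst eval_monom_sum) simp_all
    also have "\<dots> = (\<Prod>k\<in>Poly_Mapping.keys m. k x ^ Poly_Mapping.lookup m k)"
      using that by (intro prod.cong refl) (metis UN_I h(2) poly_vars_def)
    finally show ?thesis by (simp add: eval_monom_def)
  qed
  have r_keys: "Poly_Mapping.keys (r m) \<subseteq> {..<N}" if "m \<in> Poly_Mapping.keys Q" for m
  proof
    fix i assume "i \<in> Poly_Mapping.keys (r m)"
    then obtain k where "k \<in> Poly_Mapping.keys m" "i \<in> Poly_Mapping.keys (Poly_Mapping.single (h k) (Poly_Mapping.lookup m k))"
      unfolding r_def using keys_sum by fastforce
    with that h show "i \<in> {..<N}" by (auto simp: poly_vars_def split: if_splits)
  qed
  have r_0: "r m \<noteq> 0" if "m \<in> Poly_Mapping.keys Q" for m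
  proof -
    from that Q(3) have "m \<noteq> 0" by (auto simp: no_const_term_def in_keys_iff)
    then obtain k where k: "k \<in> Poly_Mapping.keys m" by (metis all_not_in_conv keys_eq_empty)
    have "Poly_Mapping.lookup (r m) (h k) = (\<Sum>l\<in>Poly_Mapping.keys m. (Poly_Mapping.lookup m l when h l = h k))"
      by (simp add: r_def lookup_sum lookup_single)
    also have "\<dots> \<ge> (Poly_Mapping.lookup m k when h k = h k)"
      using k by (intro member_le_sum) auto
    finally have "Poly_Mapping.lookup (r m) (h k) > 0" using k by (simp add: in_keys_iff)
    then show ?thesis by auto
  qed
  define P where "P = (\<Sum>m\<in>Poly_Mapping.keys Q. Poly_Mapping.single (r m) (Poly_Mapping.lookup Q m))"
  have "poly_vars P \<subseteq> {..<N}"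
  proof
    fix i assume "i \<in> poly_vars P"
    then obtain k where "k \<in> Poly_Mapping.keys P" "i \<in> Poly_Mapping.keys k" by (auto simp: poly_vars_def)
    moreover from \<open>k \<in> Poly_Mapping.keys P\<close> obtain m where "m \<in> Poly_Mapping.keys Q" "k = r m"
      unfolding P_def using keys_sum by (fastforce split: if_splits)
    ultimately show "i \<in> {..<N}" using r_keys by auto
  qed
  moreover have "no_const_term P"
    using r_0 by (simp add: no_const_term_def P_def lookup_sum lookup_single when_def)
  moreover have "g = (\<lambda>x. eval_poly P (\<lambda>i. f i x))"
  proof
    fix x
    have "eval_poly P (\<lambda>i. f i x) = (\<Sum>m\<in>Poly_Mapping.keys Q. Poly_Mapping.lookup Q m * eval_monom (r m) (\<lambda>i. f i x))"
      unfolding P_def by (subst eval_poly_sum) simp_all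
    also have "\<dots> = eval_poly Q (\<lambda>k. k x)"
      unfolding eval_poly_def by (intro sum.cong) (simp_all add: r_eval)
    finally show "g x = eval_poly P (\<lambda>i. f i x)" by (simp add: Q(1))
  qed
  ultimately show thesis using inj im Q(2) that[of P N f] by simp
qed

lemma strongly_c_algebrable_iff_poly:
  "strongly_c_algebrable A \<longleftrightarrow>
     (\<exists>B. B \<approx> (UNIV :: real set) \<and>
       (\<forall>(N::nat) P f. poly_vars P \<subseteq> {..<N} \<longrightarrow> P \<noteq> 0 \<longrightarrow> no_const_term P \<longrightarrow>
          inj_on f {..<N} \<longrightarrow> f ` {..<N} \<subseteq> B \<longrightarrow>
          (\<lambda>x. eval_poly P (\<lambda>i. f i x)) \<noteq> (\<lambda>x. 0) \<and>
          (\<lambda>x. eval_poly P (\<lambda>i. f i x)) \<in> A))"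
  (is "_ \<longleftrightarrow> (\<exists>B. _ \<and> ?R B)")
proof -
  have *: "algebraically_independent B \<and> function_algebra hull B - {\<lambda>x. 0} \<subseteq> A \<longleftrightarrow> ?R B" for B
  proof
    assume L: "algebraically_independent B \<and> function_algebra hull B - {\<lambda>x. 0} \<subseteq> A"
    show "?R B"
    proof (intro allI impI)
      fix N :: nat and P f
      assume P: "poly_vars P \<subseteq> {..<N}" "P \<noteq> 0" "no_const_term P"
        and f: "inj_on f {..<N}" "f ` {..<N} \<subseteq> B"
      have "f i \<in> function_algebra hull B" if "i \<in> poly_vars P" for i
        using that P(1) f(2) by (intro hull_inc) auto
      then have "(\<lambda>x. eval_poly P (\<lambda>i. f i x)) \<in> function_algebra hull B"
        by (intro eval_poly_in_function_algebra function_algebra_hull P)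
      moreover have "(\<lambda>x. eval_poly P (\<lambda>i. f i x)) \<noteq> (\<lambda>x. 0)"
        using L P f unfolding algebraically_independent_def by blast
      ultimately show "(\<lambda>x. eval_poly P (\<lambda>i. f i x)) \<noteq> (\<lambda>x. 0) \<and>
          (\<lambda>x. eval_poly P (\<lambda>i. f i x)) \<in> A"
        using L by blast
    qed
  next
    assume R: "?R B"
    have "g \<in> A" if g: "g \<in> function_algebra hull B" "g \<noteq> (\<lambda>x. 0)" for g
    proof -
      from g(1) obtain N :: nat and P f where
        P: "poly_vars P \<subseteq> {..<N}" "no_const_term P" "inj_on f {..<N}" "f ` {..<N} \<subseteq> B"
        and eq: "g = (\<lambda>x. eval_poly P (\<lambda>i. f i x))"
        by (rule function_algebra_hull_eq_poly)
      have "P \<noteq> 0" using g(2) eq by auto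
      with R P eq show ?thesis by blast
    qed
    moreover have "algebraically_independent B"
      unfolding algebraically_independent_def using R by blast
    ultimately show "algebraically_independent B \<and> function_algebra hull B - {\<lambda>x. 0} \<subseteq> A"
      by blast
  qed
  show ?thesis
    unfolding strongly_c_algebrable_def freely_generates_def *[symmetric] by auto
qed

end

(* The function h(x) = |y_p y_q| / |y|^3 with y = x - x0 and p \<noteq> q vanishes on the coordinate axes
   through x0, is continuous off x0 and equals 1 / (C t) at x0 + t (e_p + e_q), for t > 0.  Hence
   Q o h lies in DSC x0 whenever Q is continuous on [0,oo) and unbounded at infinity.  The generators
   are exp (h powr a) for a > 0: their monomials are exp (k_1 h^(a_1) + ... + k_N h^(a_N)), distinct
   monomials have ratios tending to 0 or oo as h tends to oo, and so a polynomial without constant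
   term in the generators has the growth of its largest monomial, which is unbounded. *)

theory Submission
  imports Defs
begin

section \<open>Asymptotic dominance in finite sums and polynomials\<close>

text \<open>Factoring out \<open>u k\<close> leaves a quotient that tends to \<open>c k\<close>, so
  the sign of \<open>c k\<close> decides the direction of divergence.\<close>

lemma filterlim_dominated_sum:
  fixes c :: "'k \<Rightarrow> real" and u :: "'k \<Rightarrow> 'x \<Rightarrow> real"
  assumes fin: "finite K" and k: "k \<in> K" and c: "c k \<noteq> 0"
    and top: "filterlim (u k) at_top F"
    and dom: "\<And>j. j \<in> K \<Longrightarrow> j \<noteq> k \<Longrightarrow> ((\<lambda>s. u j s / u k s) \<longlongrightarrow> 0) F"
  shows "filterlim (\<lambda>s. \<Sum>j\<in>K. c j * u j s) (if c k > 0 then at_top else at_bot) F"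
proof -
  define r where "r s = c k + (\<Sum>j\<in>K - {k}. c j * (u j s / u k s))" for s
  have "(r \<longlongrightarrow> c k + (\<Sum>j\<in>K - {k}. c j * 0)) F"
    unfolding r_def using dom by (intro tendsto_intros) auto
  then have r: "(r \<longlongrightarrow> c k) F" by simp
  \<comment> \<open>Positivity allows \<open>u k s\<close> to be cancelled against the denominators
    in \<open>r s\<close>.\<close>
  have "\<forall>\<^sub>F s in F. u k s > 0"
    using top by (simp add: filterlim_at_top_dense)
  then have ev: "\<forall>\<^sub>F s in F. r s * u k s = (\<Sum>j\<in>K. c j * u j s)"
  proof eventually_elim
    case (elim s)
    then show ?case
      unfolding r_def using fin k
      by (simp add: sum.remove[of K k] distrib_right sum_distrib_right)
  qed
  show ?thesis
  proof (cases "c k > 0")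
    case True
    then have "filterlim (\<lambda>s. r s * u k s) at_top F"
      by (intro filterlim_tendsto_pos_mult_at_top[OF r _ top])
    with True ev show ?thesis by (simp add: filterlim_cong[OF refl refl ev])
  next
    case False
    with c have "filterlim (\<lambda>s. r s * u k s) at_bot F"
      by (intro filterlim_tendsto_neg_mult_at_bot[OF r _ top]) auto
    with False ev show ?thesis by (simp add: filterlim_cong[OF refl refl ev])
  qed
qed

lemma filterlim_powr_at_top:
  fixes a :: real
  assumes "a > 0"
  shows "filterlim (\<lambda>s. s powr a) at_top at_top"
proof (rule filterlim_mono_eventually[OF _ order_refl order_refl])
  show "filterlim (\<lambda>s. exp (a * ln s)) at_top at_top"
    using assms by (intro filterlim_compose[OF exp_at_top]
        filterlim_tendsto_pos_mult_at_top[OF tendsto_const _ ln_at_top])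
  show "\<forall>\<^sub>F s in at_top. exp (a * ln s) = s powr a"
    using eventually_gt_at_top[of 0] by eventually_elim (simp add: powr_def)
qed

text \<open>The term with the largest exponent dominates; injectivity of \<open>a\<close> makes it
  unique.\<close>

lemma filterlim_sum_powr:
  fixes a c :: "'k \<Rightarrow> real"
  assumes fin: "finite K" and ne: "K \<noteq> {}" and inj: "inj_on a K"
    and a: "\<And>j. j \<in> K \<Longrightarrow> a j > 0" and c: "\<And>j. j \<in> K \<Longrightarrow> c j \<noteq> 0"
  obtains k where "k \<in> K"
    "filterlim (\<lambda>s. \<Sum>j\<in>K. c j * s powr a j) (if c k > 0 then at_top else at_bot) at_top"
proof -
  obtain k where k: "k \<in> K" and max: "a k = Max (a ` K)"
    using Max_in[of "a ` K"] fin ne by fastforce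
  have less: "a j < a k" if "j \<in> K" "j \<noteq> k" for j
    using that k inj fin max
    by (metis Max_ge finite_imageI imageI inj_onD order_le_less)
  have "((\<lambda>s. s powr a j / s powr a k) \<longlongrightarrow> 0) at_top" if "j \<in> K" "j \<noteq> k" for j
    unfolding powr_diff[symmetric]
    using less[OF that] by (intro tendsto_neg_powr filterlim_ident) simp
  then show thesis
    using k a c fin
    by (intro that[OF k] filterlim_dominated_sum filterlim_powr_at_top) auto
qed

text \<open>Divergence of \<open>E m - E l\<close> to infinity is a transitive relation, total on
  \<open>M\<close> by assumption, so a finite \<open>M\<close> has a greatest element.\<close>

lemma exists_dominant:
  fixes E :: "'m \<Rightarrow> 'x \<Rightarrow> real"
  assumes "finite M" "M \<noteq> {}"
    and "\<And>m l. m \<in> M \<Longrightarrow> l \<in> M \<Longrightarrow> m \<noteq> l \<Longrightarrow>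
      filterlim (\<lambda>s. E m s - E l s) at_top F \<or> filterlim (\<lambda>s. E m s - E l s) at_bot F"
  shows "\<exists>m\<in>M. \<forall>l\<in>M. l \<noteq> m \<longrightarrow> filterlim (\<lambda>s. E m s - E l s) at_top F"
  using assms
proof (induction M rule: finite_ne_induct)
  case (singleton x)
  then show ?case by simp
next
  case (insert x M)
  then obtain m where m: "m \<in> M" "\<And>l. l \<in> M \<Longrightarrow> l \<noteq> m \<Longrightarrow> filterlim (\<lambda>s. E m s - E l s) at_top F"
    by (metis insertCI)
  have "m \<noteq> x" using m(1) insert.hyps by auto
  then consider "filterlim (\<lambda>s. E m s - E x s) at_top F" | "filterlim (\<lambda>s. E m s - E x s) at_bot F"
    using insert.prems[of m x] m(1) by blast
  then show ?case
  proof cases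
    case 1
    then show ?thesis using m by (intro bexI[of _ m]) auto
  next
    case 2
    then have x: "filterlim (\<lambda>s. E x s - E m s) at_top F"
      by (simp add: filterlim_uminus_at_top)
    \<comment> \<open>Transitivity: \<open>x\<close> beats the old maximum \<open>m\<close>, hence
      everything that \<open>m\<close> beats.\<close>
    have "filterlim (\<lambda>s. E x s - E l s) at_top F" if "l \<in> M" for l
    proof (cases "l = m")
      case False
      have "filterlim (\<lambda>s. (E x s - E m s) + (E m s - E l s)) at_top F"
        by (intro filterlim_at_top_add_at_top x m(2) that False)
      then show ?thesis by simp
    qed (use x in simp)
    then show ?thesis by (intro bexI[of _ x]) auto
  qed
qed

text \<open>\<open>E m\<close> below is the logarithm of the monomial \<open>m\<close> at the
  generators. The leading coefficient may have either sign, hence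
  \<open>at_infinity\<close>.\<close>

lemma filterlim_eval_poly_exp_powr:
  fixes P :: "'v rpoly" and a :: "'v \<Rightarrow> real"
  assumes V: "finite V" "poly_vars P \<subseteq> V" and P: "P \<noteq> 0" "no_const_term P"
    and inj: "inj_on a V" and a: "\<And>i. a i > 0"
  shows "filterlim (\<lambda>s. eval_poly P (\<lambda>i. exp (s powr a i))) at_infinity at_top"
proof -
  define E where "E m s = (\<Sum>i\<in>V. real (Poly_Mapping.lookup m i) * s powr a i)"
    for m :: "'v \<Rightarrow>\<^sub>0 nat" and s
  let ?M = "Poly_Mapping.keys P"
  have keys: "Poly_Mapping.keys m \<subseteq> V" if "m \<in> ?M" for m
    using that V(2) by (auto simp: poly_vars_def)
  have diff: "\<exists>k\<in>V. Poly_Mapping.lookup m k \<noteq> Poly_Mapping.lookup l k \<and>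
      filterlim (\<lambda>s. E m s - E l s)
        (if Poly_Mapping.lookup m k > Poly_Mapping.lookup l k then at_top else at_bot) at_top"
    if m: "Poly_Mapping.keys m \<subseteq> V" and l: "Poly_Mapping.keys l \<subseteq> V" and "m \<noteq> l" for m l
  proof -
    define c where "c i = real (Poly_Mapping.lookup m i) - real (Poly_Mapping.lookup l i)" for i
    \<comment> \<open>Variables with equal exponents in \<open>m\<close> and \<open>l\<close> cancel
      in \<open>E m - E l\<close>; the rest form a sum of powers with nonzero coefficients.\<close>
    define K where "K = {i \<in> V. c i \<noteq> 0}"
    have K: "K \<subseteq> V" "finite K" using V by (auto simp: K_def)
    obtain i where i: "Poly_Mapping.lookup m i \<noteq> Poly_Mapping.lookup l i"
      using \<open>m \<noteq> l\<close> poly_mapping_eqI[of m l] by blast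
    then have "i \<in> Poly_Mapping.keys m \<union> Poly_Mapping.keys l" by (auto simp: in_keys_iff)
    then have "i \<in> V" using m l by blast
    with i have "i \<in> K" by (simp add: K_def c_def)
    then have ne: "K \<noteq> {}" by blast
    have c: "c j \<noteq> 0" if "j \<in> K" for j using that by (simp add: K_def)
    obtain k where k: "k \<in> K"
      "filterlim (\<lambda>s. \<Sum>j\<in>K. c j * s powr a j) (if c k > 0 then at_top else at_bot) at_top"
      by (rule filterlim_sum_powr[OF K(2) ne inj_on_subset[OF inj K(1)] a c]) blast
    have "E m s - E l s = (\<Sum>j\<in>K. c j * s powr a j)" for s
    proof -
      have "E m s - E l s = (\<Sum>j\<in>V. c j * s powr a j)"
        by (simp add: E_def c_def left_diff_distrib sum_subtractf)
      also have "\<dots> = (\<Sum>j\<in>K. c j * s powr a j)"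
        using V by (intro sum.mono_neutral_right) (auto simp: K_def)
      finally show ?thesis .
    qed
    with k show ?thesis by (intro bexI[of _ k]) (auto simp: K_def c_def)
  qed
  have "\<exists>m\<in>?M. \<forall>l\<in>?M. l \<noteq> m \<longrightarrow> filterlim (\<lambda>s. E m s - E l s) at_top at_top"
  proof (rule exists_dominant)
    fix m l assume "m \<in> ?M" "l \<in> ?M" "m \<noteq> l"
    then show "filterlim (\<lambda>s. E m s - E l s) at_top at_top \<or>
        filterlim (\<lambda>s. E m s - E l s) at_bot at_top"
      using diff[of m l] keys by (metis (full_types))
  qed (use P in auto)
  then obtain m where m: "m \<in> ?M"
    and dom: "\<And>l. l \<in> ?M \<Longrightarrow> l \<noteq> m \<Longrightarrow> filterlim (\<lambda>s. E m s - E l s) at_top at_top"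
    by blast
  have "m \<noteq> 0" using m P(2) by (auto simp: no_const_term_def in_keys_iff)
  \<comment> \<open>Comparison with the monomial 0, where \<open>E 0 = 0\<close>: exponents are
    natural numbers, so the one that differs from 0 is larger and the limit is
    \<open>at_top\<close>.\<close>
  then have Em: "filterlim (E m) at_top at_top"
    using diff[of m 0] keys[OF m] by (auto simp: E_def[of 0] split: if_splits)
  have "filterlim (\<lambda>s. \<Sum>l\<in>?M. Poly_Mapping.lookup P l * exp (E l s))
      (if Poly_Mapping.lookup P m > 0 then at_top else at_bot) at_top"
  proof (rule filterlim_dominated_sum[OF _ m])
    show "filterlim (\<lambda>s. exp (E m s)) at_top at_top"
      by (rule filterlim_compose[OF exp_at_top Em])
    fix l assume l: "l \<in> ?M" "l \<noteq> m"
    \<comment> \<open>Exponentiation turns differences of logarithms into ratios of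
      monomials.\<close>
    have "filterlim (\<lambda>s. - (E m s - E l s)) at_bot at_top"
      using dom[OF l] by (simp only: filterlim_uminus_at_top minus_minus)
    then have "((\<lambda>s. exp (- (E m s - E l s))) \<longlongrightarrow> 0) at_top"
      by (rule filterlim_compose[OF exp_at_bot])
    then show "((\<lambda>s. exp (E l s) / exp (E m s)) \<longlongrightarrow> 0) at_top"
      by (simp add: exp_diff)
  qed (use m in \<open>auto simp: in_keys_iff\<close>)
  then have "filterlim (\<lambda>s. \<Sum>l\<in>?M. Poly_Mapping.lookup P l * exp (E l s)) at_infinity at_top"
    by (auto intro: filterlim_mono at_top_le_at_infinity at_bot_le_at_infinity split: if_splits)
  moreover have "eval_monom l (\<lambda>i. exp (s powr a i)) = exp (E l s)" if "l \<in> ?M" for l s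
    using V(1) keys[OF that]
    by (simp add: eval_monom_superset[of V] E_def exp_sum exp_of_nat_mult)
  ultimately show ?thesis by (simp add: eval_poly_def)
qed

section \<open>A function with a pole at one point that vanishes on the axes through it\<close>

text \<open>The power 3 exceeds the degree 2 of the numerator, giving homogeneity of degree -1 under
  positive scaling about \<open>x0\<close>. At \<open>x0\<close> division by zero yields 0, matching
  the axes.\<close>

definition spike :: "'n \<Rightarrow> 'n \<Rightarrow> real ^ 'n \<Rightarrow> real ^ 'n \<Rightarrow> real" where
  "spike p q x0 x = \<bar>(x $ p - x0 $ p) * (x $ q - x0 $ q)\<bar> / norm (x - x0) ^ 3"

lemma spike_nonneg: "spike p q x0 x \<ge> 0"
  by (simp add: spike_def)

lemma spike_on_diagonal:
  fixes x0 :: "real ^ 'n"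
  assumes "p \<noteq> q"
  obtains C where "C > 0"
    "\<And>t. t > 0 \<Longrightarrow> spike p q x0 (x0 + t *\<^sub>R (axis p 1 + axis q 1)) = 1 / (C * t)"
proof -
  define v :: "real ^ 'n" where "v = axis p 1 + axis q 1"
  have v: "v $ p = 1" "v $ q = 1" using assms by (auto simp: v_def axis_def)
  then have "v \<noteq> 0" by (metis zero_index zero_neq_one)
  \<comment> \<open>This is \<open>C\<close>: at \<open>x0 + t *\<^sub>R v\<close> the numerator is
    \<open>t^2\<close> and the denominator \<open>(t * norm v)^3\<close>.\<close>
  then have "norm v ^ 3 > 0" by simp
  moreover have "spike p q x0 (x0 + t *\<^sub>R v) = 1 / (norm v ^ 3 * t)" if "t > 0" for t
    unfolding spike_def using v that
    by (simp add: power_mult_distrib power3_eq_cube abs_mult)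
  ultimately show thesis using that unfolding v_def by blast
qed

lemma continuous_spike_compose_in_DSC:
  fixes Q :: "real \<Rightarrow> real" and x0 :: "real ^ 'n"
  assumes "p \<noteq> q" and Q: "continuous_on {0..} Q" and inf: "filterlim Q at_infinity at_top"
  shows "(\<lambda>x. Q (spike p q x0 x)) \<in> DSC x0"
proof -
  let ?f = "\<lambda>x. Q (spike p q x0 x)"
  have "continuous_on (- {x0}) (spike p q x0)"
    unfolding spike_def by (intro continuous_intros) auto
  then have off: "continuous_on (- {x0}) ?f"
    by (rule continuous_on_compose2[OF Q]) (auto simp: spike_nonneg)
  have "continuous_on UNIV (\<lambda>t. ?f (\<chi> j. if j = i then t else x $ j))" for i x
  \<comment> \<open>The line parallel to axis \<open>i\<close> misses \<open>x0\<close> exactly when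
    another coordinate differs from that of \<open>x0\<close>.\<close>
  proof (cases "\<exists>j. j \<noteq> i \<and> x $ j \<noteq> x0 $ j")
    case True
    then have "(\<chi> j. if j = i then t else x $ j) \<noteq> x0" for t
      by (auto simp: vec_eq_iff)
    moreover have "continuous_on UNIV (\<lambda>t. \<chi> j. if j = i then t else x $ j)"
    proof (intro continuous_on_vec_lambda)
      show "continuous_on UNIV (\<lambda>t. if j = i then t else x $ j)" for j
        by (cases "j = i") auto
    qed
    ultimately show ?thesis
      by (intro continuous_on_compose2[OF off]) auto
  next
    case False
    \<comment> \<open>One of \<open>p\<close> and \<open>q\<close> differs from \<open>i\<close>, so
      a factor of the numerator vanishes along the whole line and the composition is
      constant.\<close>
    then have "spike p q x0 (\<chi> j. if j = i then t else x $ j) = 0" for t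
      using \<open>p \<noteq> q\<close> by (auto simp: spike_def)
    then show ?thesis by simp
  qed
  then have "separately_continuous ?f" by (simp add: separately_continuous_def)
  moreover have "isCont ?f x" if "x \<noteq> x0" for x
    using off that continuous_on_eq_continuous_at[of "- {x0}" ?f] by auto
  moreover have "\<not> isCont ?f x0"
  proof
    \<comment> \<open>Along this path into \<open>x0\<close> the spike tends to infinity, so the
      composition is unbounded and cannot converge to its value at \<open>x0\<close>.\<close>
    define g :: "real \<Rightarrow> real ^ 'n" where "g t = x0 + t *\<^sub>R (axis p 1 + axis q 1)" for t
    obtain C where C: "C > 0" "\<And>t. t > 0 \<Longrightarrow> spike p q x0 (g t) = 1 / (C * t)"
      unfolding g_def by (rule spike_on_diagonal[OF \<open>p \<noteq> q\<close>]) blast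
    have "(g \<longlongrightarrow> x0 + 0 *\<^sub>R (axis p 1 + axis q 1)) (at_right 0)"
      unfolding g_def by (intro tendsto_intros)
    moreover assume "isCont ?f x0"
    ultimately have lim: "((\<lambda>t. ?f (g t)) \<longlongrightarrow> ?f x0) (at_right 0)"
      using isCont_tendsto_compose[of x0 ?f g] by simp
    have "filterlim (\<lambda>t. inverse C * inverse t) at_top (at_right 0)"
      using C(1) by (intro filterlim_tendsto_pos_mult_at_top[OF tendsto_const]
          filterlim_inverse_at_top_right) simp
    moreover have "\<forall>\<^sub>F t in at_right 0. inverse C * inverse t = spike p q x0 (g t)"
      using C(2) by (intro eventually_at_rightI[where b = 1]) (auto simp: field_simps)
    ultimately have "filterlim (\<lambda>t. spike p q x0 (g t)) at_top (at_right 0)"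
      by (rule filterlim_mono_eventually[OF _ order_refl order_refl])
    then have "filterlim (\<lambda>t. ?f (g t)) at_infinity (at_right 0)"
      by (rule filterlim_compose[OF inf])
    with lim show False
      by (rule not_tendsto_and_filterlim_at_infinity[OF trivial_limit_at_right_real])
  qed
  ultimately show ?thesis by (simp add: DSC_def)
qed

text \<open>Reduces nonvanishing of polynomials in the generators to their membership in
  \<open>DSC x0\<close>.\<close>

lemma zero_notin_DSC: "(\<lambda>x. 0) \<notin> DSC x0"
  by (simp add: DSC_def)

section \<open>The generators and their algebraic independence\<close>

theorem theorem5p1:
  fixes x0 :: "real ^ 'n"
  assumes "CARD('n) \<ge> 2"
  shows "strongly_c_algebrable (DSC x0)"
proof -
  obtain p q :: 'n where pq: "p \<noteq> q"
    using assms card_le_Suc0_iff_eq[of "UNIV :: 'n set"] by auto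
  \<comment> \<open>Writing the positive exponent as \<open>exp r\<close> indexes the generators by
    all reals.\<close>
  define F where "F r x = exp (spike p q x0 x powr exp r)" for r x
  have "inj F"
  proof (rule injI)
    fix r r' assume eq: "F r = F r'"
    obtain C where C: "C > 0"
      "\<And>t. t > 0 \<Longrightarrow> spike p q x0 (x0 + t *\<^sub>R (axis p 1 + axis q 1)) = 1 / (C * t)"
      by (rule spike_on_diagonal[OF pq]) blast
    \<comment> \<open>The point is chosen to give the spike the value 2, a base for which
      \<open>powr\<close> is injective in the exponent.\<close>
    then have "spike p q x0 (x0 + (1 / (2 * C)) *\<^sub>R (axis p 1 + axis q 1)) = 2" by simp
    with fun_cong[OF eq, of "x0 + (1 / (2 * C)) *\<^sub>R (axis p 1 + axis q 1)"]
    show "r = r'" by (simp add: F_def powr_inj)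
  qed
  then have "range F \<approx> (UNIV :: real set)"
    by (rule inj_on_image_eqpoll_self)
  moreover have "(\<lambda>x. eval_poly P (\<lambda>i. f i x)) \<in> DSC x0"
    if P: "poly_vars P \<subseteq> {..<N}" "P \<noteq> 0" "no_const_term P"
      and f: "inj_on f {..<N}" "f ` {..<N} \<subseteq> range F" for N :: nat and P f
  proof -
    define r where "r i = inv F (f i)" for i
    have r: "f i = F (r i)" if "i < N" for i
      using f(2) that by (auto simp: r_def f_inv_into_f)
    define Q where "Q s = eval_poly P (\<lambda>i. exp (s powr exp (r i)))" for s
    have "inj_on r {..<N}"
      using f(1) r by (metis inj_on_def lessThan_iff)
    then have "inj_on (\<lambda>i. exp (r i)) {..<N}" by (simp add: inj_on_def)
    then have inf: "filterlim Q at_infinity at_top"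
      unfolding Q_def by (intro filterlim_eval_poly_exp_powr[OF _ P]) auto
    \<comment> \<open>Continuity at \<open>s = 0\<close> rests on the positivity of the exponent
      \<open>exp (r i)\<close>.\<close>
    have "continuous_on {0..} (\<lambda>s. exp (s powr exp (r i)))" for i
      by (intro continuous_on_exp continuous_on_powr' continuous_on_id continuous_on_const) simp
    then have "continuous_on {0..} Q"
      unfolding Q_def eval_poly_def eval_monom_def
      by (intro continuous_on_sum continuous_on_mult continuous_on_prod continuous_on_power
          continuous_on_const)
    from continuous_spike_compose_in_DSC[OF pq this inf]
    have "(\<lambda>x. Q (spike p q x0 x)) \<in> DSC x0" .
    \<comment> \<open>\<open>f i = F (r i)\<close> is known only for \<open>i < N\<close>, which
      covers all variables of \<open>P\<close>.\<close>
    moreover have "eval_poly P (\<lambda>i. f i x) = Q (spike p q x0 x)" for x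
      unfolding Q_def eval_poly_def eval_monom_def
      using P(1) r by (intro sum.cong prod.cong arg_cong2[of _ _ _ _ "(*)"] refl)
        (force simp: poly_vars_def F_def)
    ultimately show ?thesis by simp
  qed
  ultimately show ?thesis
    unfolding strongly_c_algebrable_iff_poly using zero_notin_DSC by metis
qed

end
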